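(* Let $G=\langle Ag, AP, Q, q_0, (Act_a)_{a\in Ag}, \delta, F, \lambda\rangle$ be a concurrent game structure with final states, let $A\subseteq Ag$ be a coalition, and let $\psi$ be an LTL$_f$ formula over $AP$. Let $\mathcal{A}_\psi=\langle S, s_0, 2^{AP}, \Delta, F'\rangle$ be a DFA recognising exactly the finite words $\lambda(\pi_0)\lambda(\pi_1)\cdots\lambda(\pi_n)$ of those finite state sequences $\pi$ that satisfy $\psi$ under the finite-trace semantics. Form the product $G\otimes\mathcal{A}_\psi$ with state set $Q\times S$ and transitions $((q,s),\alpha_A)\to(q',s')$ iff there is $\alpha_{-A}\in\prod_{b\in Ag\setminus A}Act_b$ with $\delta(q,\alpha_A\cup\alpha_{-A})=q'$ and $\Delta(s,\lambda(q'))=s'$. Let $Safe=\{(q,s)\in Q\times S : q\notin F \text{ or } s\in F'\}$, let $Pre(Y)=\{(q,s) : \exists \alpha_A\in\prod_{a\in A}Act_a\ \forall (q',s')\,( ((q,s),\alpha_A)\to(q',s') \Rightarrow (q',s')\in Y)\}$, and let $W$ be the greatest fixpoint of $Y\mapsto Safe\cap Pre(Y)$ (computed by iterating $Y_0=Safe$, $Y_{i+1}=Y_i\cap Pre(Y_i)$ until stabilisation). Then for every state $q\in Q$: $(G,q)\models_f \langle\!\langle A\rangle\!\rangle\psi$ if and only if $(q,\Delta(s_0,\lambda(q)))\in W$.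
   Context: A concurrent game structure (CGS) with final states is a tuple $G=\langle Ag, AP, Q, q_0, (Act_a)_{a\in Ag}, \delta, F, \lambda\rangle$: $Ag$ a finite nonempty set of agents, $AP$ a finite nonempty set of atomic propositions, $Q$ a finite nonempty set of states with initial state $q_0$, $Act_a$ a finite nonempty set of actions of agent $a$, $\delta: Q\times JAct\to Q$ the transition function where $JAct=\prod_{a\in Ag}Act_a$ (joint actions; for $A\subseteq Ag$, $\alpha_A$ denotes a tuple of actions for the agents in $A$ and $\alpha_A\cup\alpha_{-A}$ the combined joint action), $F\subseteq Q$ a set of final states, and $\lambda:Q\to 2^{AP}$ a labelling. A history is a finite sequence $\pi_0\cdots\pi_n$ of states with $\pi_{i+1}=\delta(\pi_i,J_i)$ for some joint actions $J_i$; a finite path is a history ending in a state of $F$. A (perfect-recall) strategy for agent $a$ is a map from histories to $Act_a$; a joint strategy $\sigma_A$ for $A$ assigns a strategy to each $a\in A$. The finite outcome $\mathrm{out}_f(q,\sigma_A)$ is the set of finite paths $\pi$ with $\pi_0=q$ such that for every $i<|\pi|-1$ there is $J\in JAct$ with $\pi_{i+1}=\delta(\pi_i,J)$ and $J(a)=\sigma_A(a)(\pi_0\cdots\pi_i)$ for all $a\in A$. LTL$_f$ formulas are $\psi::=p\mid\neg\psi\mid\psi\wedge\psi\mid \mathsf X\psi\mid\psi\,\mathsf U\,\psi$ ($p\in AP$), evaluated on a finite sequence $\pi$: $\pi\models p$ iff $p\in\lambda(\pi_0)$; Boolean cases as usual; $\pi\models\mathsf X\psi$ iff $|\pi|>1$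 and $\pi_{\ge1}\models\psi$; $\pi\models\psi_1\mathsf U\psi_2$ iff there is $j<|\pi|$ with $\pi_{\ge j}\models\psi_2$ and $\pi_{\ge k}\models\psi_1$ for all $k<j$ (here $\pi_{\ge i}$ is the suffix from position $i$). Finite-trace strategic semantics: $(G,q)\models_f\langle\!\langle A\rangle\!\rangle\psi$ iff there exists a joint strategy $\sigma_A$ such that every $\pi\in\mathrm{out}_f(q,\sigma_A)$ satisfies $\psi$. A DFA $\langle S,s_0,\Sigma,\Delta,F'\rangle$ has transition function $\Delta:S\times\Sigma\to S$ and accepts a finite word iff its run from $s_0$ ends in $F'$. *)

theory Defs
  imports Main "HOL-Library.FuncSet"
begin

record ('ag, 'p, 'q, 'act) cgs =
  agents :: "'ag set"
  props :: "'p set"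
  states :: "'q set"
  init :: 'q
  acts :: "'ag \<Rightarrow> 'act set"
  trans :: "'q \<Rightarrow> ('ag \<Rightarrow> 'act) \<Rightarrow> 'q"
  final :: "'q set"
  label :: "'q \<Rightarrow> 'p set"

text \<open>
  Tuples of actions are extensional functions, so that the functions in
  \<open>group_actions G A\<close> correspond one-to-one to the tuples in the product of
  the action sets of the agents in \<open>A\<close>. The individual action sets are
  subsets of one common type, but otherwise unrelated.
\<close>

definition group_actions :: "('ag, 'p, 'q, 'act) cgs \<Rightarrow> 'ag set \<Rightarrow> ('ag \<Rightarrow> 'act) set" where
  "group_actions G A = (\<Pi>\<^sub>E a\<in>A. acts G a)"

definition joint_actions :: "('ag, 'p, 'q, 'act) cgs \<Rightarrow> ('ag \<Rightarrow> 'act) set" where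
  "joint_actions G = group_actions G (agents G)"

locale concurrent_game_structure =
  fixes G :: "('ag, 'p, 'q, 'act) cgs"
  assumes finite_agents: "finite (agents G)" and agents_nonempty: "agents G \<noteq> {}"
    and finite_props: "finite (props G)" and props_nonempty: "props G \<noteq> {}"
    and finite_states: "finite (states G)" and init_state: "init G \<in> states G"
    and finite_acts: "\<And>a. a \<in> agents G \<Longrightarrow> finite (acts G a)"
    and acts_nonempty: "\<And>a. a \<in> agents G \<Longrightarrow> acts G a \<noteq> {}"
    and trans_closed:
      "\<And>q J. q \<in> states G \<Longrightarrow> J \<in> joint_actions G \<Longrightarrow> trans G q J \<in> states G"
    and final_subset: "final G \<subseteq> states G"
    and label_subset: "\<And>q. q \<in> states G \<Longrightarrow> label G q \<subseteq> props G"

definition histories :: "('ag, 'p, 'q, 'act) cgs \<Rightarrow> 'q list set" where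
  "histories G =
     {\<pi>. \<pi> \<noteq> [] \<and> set \<pi> \<subseteq> states G \<and>
        (\<forall>i < length \<pi> - 1. \<exists>J \<in> joint_actions G. \<pi> ! (i + 1) = trans G (\<pi> ! i) J)}"

definition finite_paths :: "('ag, 'p, 'q, 'act) cgs \<Rightarrow> 'q list set" where
  "finite_paths G = {\<pi> \<in> histories G. last \<pi> \<in> final G}"

text \<open>
  Only the values of a joint strategy on agents in \<open>A\<close> and on histories are
  ever used, so extensionality is not imposed here.
\<close>

definition joint_strategies ::
  "('ag, 'p, 'q, 'act) cgs \<Rightarrow> 'ag set \<Rightarrow> ('ag \<Rightarrow> 'q list \<Rightarrow> 'act) set" where
  "joint_strategies G A = (\<Pi> a\<in>A. histories G \<rightarrow> acts G a)"

definition finite_outcome ::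
  "('ag, 'p, 'q, 'act) cgs \<Rightarrow> 'ag set \<Rightarrow> 'q \<Rightarrow> ('ag \<Rightarrow> 'q list \<Rightarrow> 'act) \<Rightarrow> 'q list set" where
  "finite_outcome G A q \<sigma> =
     {\<pi> \<in> finite_paths G. \<pi> ! 0 = q \<and>
        (\<forall>i < length \<pi> - 1. \<exists>J \<in> joint_actions G.
           \<pi> ! (i + 1) = trans G (\<pi> ! i) J \<and> (\<forall>a\<in>A. J a = \<sigma> a (take (i + 1) \<pi>)))}"

datatype (atoms: 'p) ltlf =
    Atom 'p
  | Neg "'p ltlf"
  | Conj "'p ltlf" "'p ltlf"
  | Next "'p ltlf"
  | Until "'p ltlf" "'p ltlf"

text \<open>The semantics is only meaningful on nonempty sequences.\<close>

primrec ltlf_sat :: "('q \<Rightarrow> 'p set) \<Rightarrow> 'q list \<Rightarrow> 'p ltlf \<Rightarrow> bool" where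
  "ltlf_sat L \<pi> (Atom p) \<longleftrightarrow> p \<in> L (\<pi> ! 0)"
| "ltlf_sat L \<pi> (Neg \<psi>) \<longleftrightarrow> \<not> ltlf_sat L \<pi> \<psi>"
| "ltlf_sat L \<pi> (Conj \<psi>1 \<psi>2) \<longleftrightarrow> ltlf_sat L \<pi> \<psi>1 \<and> ltlf_sat L \<pi> \<psi>2"
| "ltlf_sat L \<pi> (Next \<psi>) \<longleftrightarrow> length \<pi> > 1 \<and> ltlf_sat L (drop 1 \<pi>) \<psi>"
| "ltlf_sat L \<pi> (Until \<psi>1 \<psi>2) \<longleftrightarrow>
     (\<exists>j < length \<pi>. ltlf_sat L (drop j \<pi>) \<psi>2 \<and> (\<forall>k < j. ltlf_sat L (drop k \<pi>) \<psi>1))"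

definition coalition_sat ::
  "('ag, 'p, 'q, 'act) cgs \<Rightarrow> 'q \<Rightarrow> 'ag set \<Rightarrow> 'p ltlf \<Rightarrow> bool" where
  "coalition_sat G q A \<psi> \<longleftrightarrow>
     (\<exists>\<sigma> \<in> joint_strategies G A. \<forall>\<pi> \<in> finite_outcome G A q \<sigma>. ltlf_sat (label G) \<pi> \<psi>)"

record ('s, 'l) dfa =
  dstates :: "'s set"
  dinit :: 's
  alphabet :: "'l set"
  dtrans :: "'s \<Rightarrow> 'l \<Rightarrow> 's"
  accepting :: "'s set"

locale deterministic_finite_automaton =
  fixes M :: "('s, 'l) dfa"
  assumes finite_dstates: "finite (dstates M)"
    and dinit_state: "dinit M \<in> dstates M"
    and finite_alphabet: "finite (alphabet M)"
    and dtrans_closed: "\<And>s l. s \<in> dstates M \<Longrightarrow> l \<in> alphabet M \<Longrightarrow> dtrans M s l \<in> dstates M"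
    and accepting_subset: "accepting M \<subseteq> dstates M"

definition language :: "('s, 'l) dfa \<Rightarrow> 'l list set" where
  "language M = {w \<in> lists (alphabet M). foldl (dtrans M) (dinit M) w \<in> accepting M}"

definition product_states :: "('ag, 'p, 'q, 'act) cgs \<Rightarrow> ('s, 'p set) dfa \<Rightarrow> ('q \<times> 's) set" where
  "product_states G M = states G \<times> dstates M"

text \<open>
  \<open>override_on \<beta> \<alpha> A\<close> is the combined joint action: it agrees with \<open>\<alpha>\<close> on
  \<open>A\<close> and with \<open>\<beta>\<close> elsewhere.
\<close>

fun product_step ::
  "('ag, 'p, 'q, 'act) cgs \<Rightarrow> ('s, 'p set) dfa \<Rightarrow> 'ag set \<Rightarrow>
   'q \<times> 's \<Rightarrow> ('ag \<Rightarrow> 'act) \<Rightarrow> 'q \<times> 's \<Rightarrow> bool" where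
  "product_step G M A (q, s) \<alpha> (q', s') \<longleftrightarrow>
     (\<exists>\<beta> \<in> group_actions G (agents G - A).
        trans G q (override_on \<beta> \<alpha> A) = q' \<and> dtrans M s (label G q') = s')"

definition Safe :: "('ag, 'p, 'q, 'act) cgs \<Rightarrow> ('s, 'p set) dfa \<Rightarrow> ('q \<times> 's) set" where
  "Safe G M = {(q, s) \<in> product_states G M. q \<notin> final G \<or> s \<in> accepting M}"

definition Pre ::
  "('ag, 'p, 'q, 'act) cgs \<Rightarrow> ('s, 'p set) dfa \<Rightarrow> 'ag set \<Rightarrow> ('q \<times> 's) set \<Rightarrow> ('q \<times> 's) set" where
  "Pre G M A Y =
     {x \<in> product_states G M.
        \<exists>\<alpha> \<in> group_actions G A. \<forall>y. product_step G M A x \<alpha> y \<longrightarrow> y \<in> Y}"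

definition winning_region ::
  "('ag, 'p, 'q, 'act) cgs \<Rightarrow> ('s, 'p set) dfa \<Rightarrow> 'ag set \<Rightarrow> ('q \<times> 's) set" where
  "winning_region G M A = gfp (\<lambda>Y. Safe G M \<inter> Pre G M A Y)"

primrec safe_iter ::
  "('ag, 'p, 'q, 'act) cgs \<Rightarrow> ('s, 'p set) dfa \<Rightarrow> 'ag set \<Rightarrow> nat \<Rightarrow> ('q \<times> 's) set" where
  "safe_iter G M A 0 = Safe G M"
| "safe_iter G M A (Suc i) = safe_iter G M A i \<inter> Pre G M A (safe_iter G M A i)"

end

theory Submission imports Defs begin

text \<open>
  The automaton is deterministic, so a history \<open>h\<close> determines the product state
  \<open>(last h, s)\<close>, where \<open>s\<close> is the state reached on the labels of \<open>h\<close>. A memoryless choice of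
  actions staying in the winning region therefore yields a perfect-recall strategy on \<open>G\<close>.
  Conversely, the product states reached by the histories consistent with a winning strategy
  form a post-fixpoint of the operator defining the winning region.
\<close>

section \<open>Label invariance of the semantics, and finite descending chains\<close>

text \<open>The semantics inspects states only through \<open>L\<close>. This matters because
  membership in a language of label words only yields some sequence with the same labels as
  \<open>\<pi>\<close>.\<close>

lemma ltlf_sat_cong_labels:
  "map L \<pi> = map L \<pi>' \<Longrightarrow> \<pi> \<noteq> [] \<Longrightarrow> ltlf_sat L \<pi> \<psi> \<longleftrightarrow> ltlf_sat L \<pi>' \<psi>"
proof (induction \<psi> arbitrary: \<pi> \<pi>')
  case (Atom p)
  then have "\<pi>' \<noteq> []" by auto
  with Atom have "L (\<pi> ! 0) = L (\<pi>' ! 0)" by (metis length_greater_0_conv nth_map)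
  then show ?case by simp
next
  case (Next \<psi>)
  have len: "length \<pi> = length \<pi>'" by (rule map_eq_imp_length_eq[OF Next.prems(1)])
  have "map L (drop 1 \<pi>) = map L (drop 1 \<pi>')" by (simp only: drop_map[symmetric] Next.prems(1))
  then have "ltlf_sat L (drop 1 \<pi>) \<psi> \<longleftrightarrow> ltlf_sat L (drop 1 \<pi>') \<psi>" if "length \<pi> > 1"
    using that by (intro Next.IH) auto
  with len show ?case by auto
next
  case (Until \<psi>1 \<psi>2)
  have len: "length \<pi> = length \<pi>'" by (rule map_eq_imp_length_eq[OF Until.prems(1)])
  have "map L (drop j \<pi>) = map L (drop j \<pi>')" for j
    by (simp only: drop_map[symmetric] Until.prems(1))
  \<comment> \<open>The bound on \<open>j\<close> keeps the suffix nonempty, as the induction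
    hypotheses demand. Each \<open>k < j\<close> in the semantics of \<open>Until\<close> inherits
    it.\<close>
  then have "ltlf_sat L (drop j \<pi>) \<psi>1 \<longleftrightarrow> ltlf_sat L (drop j \<pi>') \<psi>1"
    "ltlf_sat L (drop j \<pi>) \<psi>2 \<longleftrightarrow> ltlf_sat L (drop j \<pi>') \<psi>2" if "j < length \<pi>" for j
    using that by (auto intro!: Until.IH)
  with len show ?case unfolding ltlf_sat.simps by (metis order.strict_trans)
next
  case (Neg \<psi>)
  then show ?case unfolding ltlf_sat.simps by metis
next
  case (Conj \<psi>1 \<psi>2)
  then show ?case unfolding ltlf_sat.simps by metis
qed

text \<open>A strict descent loses at least one element per step, so \<open>card (Y i) + i\<close>
  could never exceed \<open>card (Y 0)\<close>, which fails once \<open>i\<close> is large.\<close>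

lemma decreasing_finite_sets_stabilise:
  fixes Y :: "nat \<Rightarrow> 'a set"
  assumes "finite (Y 0)" and dec: "\<And>i. Y (Suc i) \<subseteq> Y i"
  shows "\<exists>i. Y (Suc i) = Y i"
proof (rule ccontr)
  assume "\<nexists>i. Y (Suc i) = Y i"
  with dec have psub: "Y (Suc i) \<subset> Y i" for i by blast
  have "finite (Y i) \<and> card (Y i) + i \<le> card (Y 0)" for i
  proof (induction i)
    case (Suc i)
    then have "finite (Y (Suc i))" using dec finite_subset by blast
    moreover have "card (Y (Suc i)) < card (Y i)" using Suc psub by (simp add: psubset_card_mono)
    ultimately show ?case using Suc by simp
  qed (simp add: assms)
  from this[of "Suc (card (Y 0))"] show False by simp
qed

section \<open>Consistent histories and automaton runs\<close>

text \<open>The finite outcome without the demand that the last state be final. Dropping it makes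
  the set closed under every further move that respects \<open>\<sigma>\<close>.\<close>

definition consistent_histories ::
  "('ag, 'p, 'q, 'act) cgs \<Rightarrow> 'ag set \<Rightarrow> 'q \<Rightarrow> ('ag \<Rightarrow> 'q list \<Rightarrow> 'act) \<Rightarrow> 'q list set" where
  "consistent_histories G A q \<sigma> =
     {\<pi> \<in> histories G. \<pi> ! 0 = q \<and>
        (\<forall>i < length \<pi> - 1. \<exists>J \<in> joint_actions G.
           \<pi> ! (i + 1) = trans G (\<pi> ! i) J \<and> (\<forall>a\<in>A. J a = \<sigma> a (take (i + 1) \<pi>)))}"

lemma finite_outcome_eq:
  "finite_outcome G A q \<sigma> = {\<pi> \<in> consistent_histories G A q \<sigma>. last \<pi> \<in> final G}"
  by (auto simp: finite_outcome_def consistent_histories_def finite_paths_def)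

definition dfa_run :: "('s, 'l) dfa \<Rightarrow> ('q \<Rightarrow> 'l) \<Rightarrow> 'q list \<Rightarrow> 's" where
  "dfa_run M L \<pi> = foldl (dtrans M) (dinit M) (map L \<pi>)"

lemma dfa_run_snoc: "dfa_run M L (\<pi> @ [q]) = dtrans M (dfa_run M L \<pi>) (L q)"
  by (simp add: dfa_run_def)

section \<open>The winning region as greatest fixpoint and as limit of the iteration\<close>

lemma mono_Safe_Pre: "mono (\<lambda>Y. Safe G M \<inter> Pre G M A Y)"
  by (rule monoI) (fastforce simp: Pre_def)

lemma winning_region_unfold:
  "winning_region G M A = Safe G M \<inter> Pre G M A (winning_region G M A)"
  unfolding winning_region_def by (rule gfp_unfold[OF mono_Safe_Pre])

lemma winning_region_subset_safe_iter: "winning_region G M A \<subseteq> safe_iter G M A i"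
proof (induction i)
  case 0
  then show ?case using winning_region_unfold[of G M A] by auto
next
  case (Suc i)
  then have "Safe G M \<inter> Pre G M A (winning_region G M A) \<subseteq> Safe G M \<inter> Pre G M A (safe_iter G M A i)"
    by (rule monoD[OF mono_Safe_Pre])
  then show ?case using Suc winning_region_unfold[of G M A] by auto
qed

lemma safe_iter_subset_Safe: "safe_iter G M A i \<subseteq> Safe G M"
  by (induction i) auto

text \<open>A stable iterate lies in \<open>Safe\<close> and in \<open>Pre\<close> of itself, so it
  is a post-fixpoint and hence below the greatest fixpoint. The other inclusion holds for every
  iterate.\<close>

lemma stable_safe_iter_eq_winning_region:
  assumes "safe_iter G M A (Suc i) = safe_iter G M A i"
  shows "safe_iter G M A i = winning_region G M A"
proof
  have "safe_iter G M A i \<subseteq> Safe G M \<inter> Pre G M A (safe_iter G M A i)"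
    using assms safe_iter_subset_Safe[of G M A i] by auto
  then show "safe_iter G M A i \<subseteq> winning_region G M A"
    unfolding winning_region_def by (rule gfp_upperbound)
qed (rule winning_region_subset_safe_iter)

section \<open>The product game and its moves\<close>

locale product_game = concurrent_game_structure G + deterministic_finite_automaton M
  for G :: "('ag, 'p, 'q, 'act) cgs" and M :: "('s, 'p set) dfa" +
  fixes A :: "'ag set"
  assumes coalition_subset: "A \<subseteq> agents G"
    and alphabet_eq: "alphabet M = Pow (props G)"
begin

lemma dtrans_label_closed:
  "s \<in> dstates M \<Longrightarrow> q \<in> states G \<Longrightarrow> dtrans M s (label G q) \<in> dstates M"
  by (simp add: dtrans_closed alphabet_eq label_subset)

lemma dfa_run_in_dstates: "set \<pi> \<subseteq> states G \<Longrightarrow> dfa_run M (label G) \<pi> \<in> dstates M"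
proof (induction \<pi> rule: rev_induct)
  case Nil
  then show ?case by (simp add: dfa_run_def dinit_state)
qed (simp add: dfa_run_snoc dtrans_label_closed)

lemma in_language_iff:
  "set \<pi> \<subseteq> states G \<Longrightarrow>
    map (label G) \<pi> \<in> language M \<longleftrightarrow> dfa_run M (label G) \<pi> \<in> accepting M"
  using label_subset by (fastforce simp: language_def dfa_run_def alphabet_eq)

lemma safe_iter_stabilises: "\<exists>i. safe_iter G M A (Suc i) = safe_iter G M A i"
proof (rule decreasing_finite_sets_stabilise)
  have "finite (product_states G M)"
    by (simp add: product_states_def finite_states finite_dstates)
  then show "finite (safe_iter G M A 0)"
    by (rule rev_finite_subset) (auto simp: Safe_def)
qed simp

text \<open>Trades the split into coalition and opponent actions for a single joint action agreeing
  with \<open>\<alpha>\<close> on \<open>A\<close>, the form in which outcomes are defined.\<close>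

lemma product_step_iff:
  assumes "\<alpha> \<in> group_actions G A"
  shows "product_step G M A (q, s) \<alpha> (q', s') \<longleftrightarrow>
    (\<exists>J \<in> joint_actions G. (\<forall>a\<in>A. J a = \<alpha> a) \<and> trans G q J = q') \<and> dtrans M s (label G q') = s'"
proof -
  have "override_on \<beta> \<alpha> A \<in> joint_actions G" if "\<beta> \<in> group_actions G (agents G - A)" for \<beta>
    using that assms coalition_subset
    by (auto simp: joint_actions_def group_actions_def override_on_def PiE_iff extensional_def)
  moreover have "\<exists>\<beta> \<in> group_actions G (agents G - A). override_on \<beta> \<alpha> A = J"
    if "J \<in> joint_actions G" "\<forall>a\<in>A. J a = \<alpha> a" for J
  proof (rule bexI)
    \<comment> \<open>On \<open>A\<close> the hypothesis on \<open>J\<close> applies, on the other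
      agents the restriction returns \<open>J\<close>, and outside \<open>agents G\<close> both
      sides are \<open>undefined\<close> by extensionality.\<close>
    show "override_on (restrict J (agents G - A)) \<alpha> A = J"
      using that coalition_subset
      by (auto simp: fun_eq_iff override_on_def joint_actions_def group_actions_def PiE_iff
          extensional_def)
    show "restrict J (agents G - A) \<in> group_actions G (agents G - A)"
      using that by (auto simp: joint_actions_def group_actions_def PiE_iff)
  qed
  ultimately have "(\<exists>\<beta> \<in> group_actions G (agents G - A). trans G q (override_on \<beta> \<alpha> A) = q') \<longleftrightarrow>
      (\<exists>J \<in> joint_actions G. (\<forall>a\<in>A. J a = \<alpha> a) \<and> trans G q J = q')"
    by (metis override_on_apply_in)
  then show ?thesis by auto
qed

lemma singleton_consistent: "q \<in> states G \<Longrightarrow> [q] \<in> consistent_histories G A q \<sigma>"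
  by (simp add: consistent_histories_def histories_def)

lemma consistent_snoc:
  assumes h: "h \<in> consistent_histories G A q \<sigma>"
    and J: "J \<in> joint_actions G" "\<forall>a\<in>A. J a = \<sigma> a h"
  shows "h @ [trans G (last h) J] \<in> consistent_histories G A q \<sigma>" (is "?h \<in> _")
proof -
  have ne: "h \<noteq> []" and sub: "set h \<subseteq> states G" and "h ! 0 = q"
    using h by (auto simp: consistent_histories_def histories_def)
  have step: "\<exists>J \<in> joint_actions G. ?h ! (i + 1) = trans G (?h ! i) J \<and>
      (\<forall>a\<in>A. J a = \<sigma> a (take (i + 1) ?h))" if "i < length ?h - 1" for i
  \<comment> \<open>The last transition is the new move, chosen after seeing exactly
    \<open>h\<close>; all earlier transitions and their prefixes lie inside
    \<open>h\<close>.\<close>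
  proof (cases "i + 1 = length h")
    case True
    then have "?h ! i = last h" using ne by (simp add: nth_append last_conv_nth flip: True)
    with True J show ?thesis by (intro bexI[of _ J]) (auto simp: nth_append)
  next
    case False
    with that have "i < length h - 1" by simp
    with h show ?thesis by (auto simp: consistent_histories_def nth_append)
  qed
  have "set ?h \<subseteq> states G" using sub last_in_set[OF ne] J trans_closed by auto
  with step have "?h \<in> histories G" unfolding histories_def by blast
  with step show ?thesis using ne \<open>h ! 0 = q\<close> by (auto simp: consistent_histories_def nth_append)
qed

section \<open>From strategies to the winning region and back\<close>

text \<open>The automaton has already read the label of the last state, so \<open>[q]\<close> is
  sent to \<open>(q, dtrans M (dinit M) (label G q))\<close> and not to
  \<open>(q, dinit M)\<close>.\<close>

definition product_state_of :: "'q list \<Rightarrow> 'q \<times> 's" where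
  "product_state_of \<pi> = (last \<pi>, dfa_run M (label G) \<pi>)"

text \<open>Reached product states are safe since a consistent history ending in a final state is an
  outcome. They lie in \<open>Pre\<close> since the actions prescribed by \<open>\<sigma>\<close>
  lead only to longer consistent histories.\<close>

lemma strategy_imp_winning_region:
  assumes q: "q \<in> states G" and \<sigma>: "\<sigma> \<in> joint_strategies G A"
    and acc: "\<And>\<pi>. \<pi> \<in> finite_outcome G A q \<sigma> \<Longrightarrow> dfa_run M (label G) \<pi> \<in> accepting M"
  shows "product_state_of [q] \<in> winning_region G M A"
proof -
  let ?Y = "product_state_of ` consistent_histories G A q \<sigma>"
  have "?Y \<subseteq> Safe G M \<inter> Pre G M A ?Y"
  proof (rule image_subsetI)
    fix h assume h: "h \<in> consistent_histories G A q \<sigma>"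
    then have hist: "h \<in> histories G" and ne: "h \<noteq> []" and sub: "set h \<subseteq> states G"
      by (auto simp: consistent_histories_def histories_def)
    have ps: "product_state_of h \<in> product_states G M"
      using ne sub by (auto simp: product_state_of_def product_states_def dfa_run_in_dstates)
    have safe: "product_state_of h \<in> Safe G M"
      using ps h acc by (auto simp: Safe_def product_state_of_def finite_outcome_eq)
    \<comment> \<open>The restriction to \<open>A\<close> supplies the extensionality that
      \<open>group_actions\<close> requires.\<close>
    let ?\<alpha> = "\<lambda>a\<in>A. \<sigma> a h"
    have \<alpha>: "?\<alpha> \<in> group_actions G A"
      using \<sigma> hist by (auto simp: joint_strategies_def group_actions_def)
    have "y \<in> ?Y" if "product_step G M A (product_state_of h) ?\<alpha> y" for y
    proof -
      obtain q' s' where y: "y = (q', s')" by (cases y)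
      with that obtain J where J: "J \<in> joint_actions G" "\<forall>a\<in>A. J a = \<sigma> a h"
        "trans G (last h) J = q'" "dtrans M (dfa_run M (label G) h) (label G q') = s'"
        by (auto simp: product_state_of_def product_step_iff[OF \<alpha>]
            simp del: product_step.simps)
      then have "h @ [q'] \<in> consistent_histories G A q \<sigma>" using consistent_snoc[OF h] by auto
      moreover have "product_state_of (h @ [q']) = y"
        using J y by (simp add: product_state_of_def dfa_run_snoc)
      ultimately show ?thesis by blast
    qed
    with ps \<alpha> safe show "product_state_of h \<in> Safe G M \<inter> Pre G M A ?Y"
      by (auto simp: Pre_def)
  qed
  then have "?Y \<subseteq> winning_region G M A" unfolding winning_region_def by (rule gfp_upperbound)
  then show ?thesis using singleton_consistent[OF q] by blast
qed

lemma winning_region_imp_strategy: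
  assumes q: "product_state_of [q] \<in> winning_region G M A"
  shows "\<exists>\<sigma> \<in> joint_strategies G A. \<forall>\<pi> \<in> finite_outcome G A q \<sigma>.
    dfa_run M (label G) \<pi> \<in> accepting M"
proof -
  let ?W = "winning_region G M A"
  have "\<forall>x\<in>?W. \<exists>\<alpha> \<in> group_actions G A. \<forall>y. product_step G M A x \<alpha> y \<longrightarrow> y \<in> ?W"
    using winning_region_unfold[of G M A] by (auto simp: Pre_def)
  then obtain c where c: "\<And>x. x \<in> ?W \<Longrightarrow> c x \<in> group_actions G A"
    and c_step: "\<And>x y. x \<in> ?W \<Longrightarrow> product_step G M A x (c x) y \<Longrightarrow> y \<in> ?W"
    by metis
  \<comment> \<open>Off the winning region the actions are irrelevant but must still be legal.\<close>
  define \<sigma> where "\<sigma> a h =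
    (if product_state_of h \<in> ?W then c (product_state_of h) a else SOME b. b \<in> acts G a)" for a h
  have "\<sigma> a h \<in> acts G a" if "a \<in> A" for a h
  proof -
    have "acts G a \<noteq> {}" using that coalition_subset acts_nonempty by auto
    then show ?thesis using that c[of "product_state_of h"]
      by (auto simp: \<sigma>_def group_actions_def PiE_iff some_in_eq)
  qed
  then have "\<sigma> \<in> joint_strategies G A" by (auto simp: joint_strategies_def)
  moreover have "dfa_run M (label G) \<pi> \<in> accepting M" if \<pi>: "\<pi> \<in> finite_outcome G A q \<sigma>" for \<pi>
  proof -
    have ne: "\<pi> \<noteq> []" and start: "\<pi> ! 0 = q" and fin: "last \<pi> \<in> final G"
      using \<pi> by (auto simp: finite_outcome_def finite_paths_def histories_def)
    \<comment> \<open>All nonempty prefixes are treated, not just \<open>\<pi>\<close>, because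
      \<open>\<sigma>\<close> is known to follow \<open>c\<close> only after a prefix that is still
      in the region.\<close>
    have "product_state_of (take (Suc i) \<pi>) \<in> ?W" if "i < length \<pi>" for i
      using that
    proof (induction i)
      case 0
      then have "take (Suc 0) \<pi> = [q]" using start by (simp add: take_Suc_conv_app_nth)
      with q show ?case by simp
    next
      case (Suc i)
      let ?h = "take (Suc i) \<pi>"
      have W: "product_state_of ?h \<in> ?W" using Suc by simp
      have last: "last ?h = \<pi> ! i" using Suc.prems by (simp add: take_Suc_conv_app_nth)
      have split: "take (Suc (Suc i)) \<pi> = ?h @ [\<pi> ! Suc i]"
        using Suc.prems by (simp only: take_Suc_conv_app_nth)
      have "i < length \<pi> - 1" using Suc.prems by simp
      with \<pi> obtain J where "J \<in> joint_actions G" "\<pi> ! Suc i = trans G (\<pi> ! i) J"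
        "\<forall>a\<in>A. J a = \<sigma> a ?h"
        by (auto simp: finite_outcome_def)
      \<comment> \<open>By \<open>W\<close>, the strategy plays \<open>c\<close> after
        \<open>?h\<close>, so \<open>J\<close> witnesses a product step under that choice.\<close>
      then have "product_step G M A (product_state_of ?h) (c (product_state_of ?h))
          (product_state_of (?h @ [\<pi> ! Suc i]))"
        using product_step_iff[OF c[OF W]] W last
        by (auto simp: \<sigma>_def product_state_of_def dfa_run_snoc simp del: product_step.simps)
      from c_step[OF W this] show ?case by (simp only: split)
    qed
    from this[of "length \<pi> - 1"] have "product_state_of \<pi> \<in> ?W" using ne by simp
    then have "product_state_of \<pi> \<in> Safe G M" using winning_region_unfold[of G M A] by blast
    \<comment> \<open>At a final state, safety can only hold through acceptance.\<close>
    with fin show ?thesis by (simp add: Safe_def product_state_of_def)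
  qed
  ultimately show ?thesis by blast
qed

end

theorem theorem1:
  fixes G :: "('ag, 'p, 'q, 'act) cgs"
    and M :: "('s, 'p set) dfa"
    and A :: "'ag set"
    and \<psi> :: "'p ltlf"
  assumes "concurrent_game_structure G"
    and "A \<subseteq> agents G"
    and "atoms \<psi> \<subseteq> props G"
    and "deterministic_finite_automaton M"
    and "alphabet M = Pow (props G)"
    and "language M =
           {map (label G) \<pi> | \<pi>. \<pi> \<noteq> [] \<and> set \<pi> \<subseteq> states G \<and> ltlf_sat (label G) \<pi> \<psi>}"
  shows "(\<exists>i. safe_iter G M A (Suc i) = safe_iter G M A i) \<and>
         (\<forall>i. safe_iter G M A (Suc i) = safe_iter G M A i \<longrightarrow>
              safe_iter G M A i = winning_region G M A) \<and>
         (\<forall>q \<in> states G.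
            coalition_sat G q A \<psi> \<longleftrightarrow>
              (q, dtrans M (dinit M) (label G q)) \<in> winning_region G M A)"
proof -
  interpret product_game G M A
    using assms by (simp add: product_game_def product_game_axioms_def)
  have sat_iff: "ltlf_sat (label G) \<pi> \<psi> \<longleftrightarrow> dfa_run M (label G) \<pi> \<in> accepting M"
    if "\<pi> \<in> histories G" for \<pi>
  proof -
    have \<pi>: "\<pi> \<noteq> []" "set \<pi> \<subseteq> states G" using that by (auto simp: histories_def)
    \<comment> \<open>Forwards, \<open>\<pi>\<close> itself is the witness. Backwards, the language
      supplies some satisfying sequence with the same labels, and label invariance carries
      satisfaction over to \<open>\<pi>\<close>.\<close>
    have "ltlf_sat (label G) \<pi> \<psi> \<longleftrightarrow> map (label G) \<pi> \<in> language M"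
      unfolding assms(6) using \<pi> ltlf_sat_cong_labels[of "label G" \<pi>] by blast
    with \<pi> show ?thesis by (simp add: in_language_iff)
  qed
  have sat_iff': "(\<forall>\<pi> \<in> finite_outcome G A q \<sigma>. ltlf_sat (label G) \<pi> \<psi>) \<longleftrightarrow>
      (\<forall>\<pi> \<in> finite_outcome G A q \<sigma>. dfa_run M (label G) \<pi> \<in> accepting M)" for q \<sigma>
    by (auto simp: finite_outcome_def finite_paths_def sat_iff)
  have "coalition_sat G q A \<psi> \<longleftrightarrow> product_state_of [q] \<in> winning_region G M A"
    if "q \<in> states G" for q
    unfolding coalition_sat_def sat_iff'
    using strategy_imp_winning_region[OF that] winning_region_imp_strategy[of q] by blast
  then show ?thesis
    using safe_iter_stabilises stable_safe_iter_eq_winning_region[of G M A]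
    by (auto simp: product_state_of_def dfa_run_def simp del: safe_iter.simps)
qed

end
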